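(* Let $F=f+\psi$ satisfy assumptions A.1, A.2, A.3 and let $(x_k)_{k\ge0}$, $(d_k)_{k\ge 0}$ be generated by algorithm CGD (see context), where one of the stepsize Rules 1, 2, 3, 4 is used for all $k$ and $\psi$ satisfies the assumption(s) attached to that rule (Rule 1: A.4 and A.5; Rule 2: A.4; Rule 3: A.5; Rule 4: A.6), with the indices $i_k\in\{1,\dots,N\}$ chosen in an arbitrary way (in particular uniformly at random or cyclically). Then $$F(x_{k+1})\le F(x_k)-\frac{\eta_{\min}}{2}\|d_k\|^2\qquad\text{for all }k\ge0 .$$
   Context: Setting: $F=f+\psi$ with $f,\psi:\mathbb{R}^n\to\mathbb{R}$, $f$ differentiable, both possibly nonconvex. $U=[U_1,\dots,U_N]\in\mathbb{R}^{n\times n}$ is a column permutation of the identity $I_n$, split into submatrices $U_i\in\mathbb{R}^{n\times n_i}$, $\sum_{i=1}^N n_i=n$. Vector norms are Euclidean, matrix norms are the induced operator norms. Assumptions. A.1: $\|U_i^T(\nabla f(x+U_ih)-\nabla f(x))\|\le L_i\|h\|$ for all $h\in\mathbb{R}^{n_i}$, $x\in\mathbb{R}^n$, $i=1,\dots,N$. A.2: $\psi$ is twice continuously differentiable. A.3: $F$ attains its minimum, $F^*:=\min F>-\infty$. A.4: there exist $H_\psi>0$ and an integer $p\ge1$ with $\|U_i^T\nabla^2\psi(y)U_i\|\le H_\psi\|y\|^p$ for all $y\in\mathbb{R}^n$, $i=1,\dots,N$. A.5: there exists $L_\psi>0$ with $\|\nabla^2\psi(y)-\nabla^2\psi(x)\|\le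 L_\psi\|y-x\|$ for all $x,y\in\mathbb{R}^n$. A.6: $\psi(x+U_id)\le\psi(x)+\langle U_i^T\nabla\psi(x),d\rangle$ for all $d\in\mathbb{R}^{n_i}$, $x\in\mathbb{R}^n$, $i=1,\dots,N$. Algorithm CGD: fix $\eta_i>0$ and set $H_{f,U_i}=\frac{L_i+\eta_i}{2}$, $i=1,\dots,N$; $\eta_{\min}=\min_i\eta_i$. Given $x_0\in\mathbb{R}^n$, for $k\ge0$: choose $i_k\in\{1,\dots,N\}$, compute $H_{F_k}>0$ by one of the rules below, set $d_k=-\frac{1}{H_{F_k}}U_{i_k}^T\nabla F(x_k)$ and $x_{k+1}=x_k+U_{i_k}d_k$. Rule 1: $\alpha_k\ge0$ is the nonnegative root of $\frac{L_\psi}{6}\alpha^2+\left(\frac{H_\psi}{2}\|x_k\|^p+H_{f,U_{i_k}}\right)\alpha-\|U_{i_k}^T\nabla F(x_k)\|=0$ and $H_{F_k}=\frac{H_\psi}{2}\|x_k\|^p+\frac{L_\psi}{6}\alpha_k+H_{f,U_{i_k}}$. Rule 2: $\alpha_k\ge0$ is the nonnegative root of $2^{p-1}H_\psi\alpha^{p+1}+(2^{p-1}H_\psi\|x_k\|^p+H_{f,U_{i_k}})\alpha=\|U_{i_k}^T\nabla F(x_k)\|$ and $H_{F_k}=2^{p-1}H_\psi\|x_k\|^p+2^{p-1}H_\psi\alpha_k^p+H_{f,U_{i_k}}$. Rule 3: $\alpha_k\ge0$ is the nonnegative root of $\frac{L_\psi}{6}\alpha^2+\left(\frac{L_\psi}{2}\|x_k-x_0\|+\frac12\|\nabla^2\psi(x_0)\|+H_{f,U_{i_k}}\right)\alpha=\|U_{i_k}^T\nabla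 F(x_k)\|$ and $H_{F_k}=\frac{L_\psi}{2}\|x_k-x_0\|+\frac12\|\nabla^2\psi(x_0)\|+\frac{L_\psi}{6}\alpha_k+H_{f,U_{i_k}}$. Rule 4: $H_{F_k}=H_{f,U_{i_k}}$. *)

theory Defs
  imports "HOL-Analysis.Analysis"
begin

text \<open>
  The ambient space is \<^typ>\<open>real ^ 'n\<close>. The block dimensions vary with the block, so a vector
  of the \<open>m\<close>-dimensional space is a function \<^typ>\<open>nat \<Rightarrow> real\<close> of which only the entries with
  index \<open>< m\<close> are used, with Euclidean norm \<^term>\<open>L2_set h {..<m}\<close>. A matrix with \<open>m\<close> columns
  in the ambient space is given by its columns, \<^typ>\<open>nat \<Rightarrow> real ^ 'n\<close>, again using only
  the first \<open>m\<close>. Blocks are numbered \<open>1, ..., N\<close>; entries and columns start at \<open>0\<close>.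
\<close>

definition blk_mult :: "nat \<Rightarrow> (nat \<Rightarrow> real ^ 'n) \<Rightarrow> (nat \<Rightarrow> real) \<Rightarrow> real ^ 'n" where
  "blk_mult m A h = (\<Sum>j<m. h j *\<^sub>R A j)"

text \<open>The product of the transpose of \<open>A\<close> with \<open>v\<close>.\<close>

definition blk_tmult :: "(nat \<Rightarrow> real ^ 'n) \<Rightarrow> real ^ 'n \<Rightarrow> nat \<Rightarrow> real" where
  "blk_tmult A v = (\<lambda>j. A j \<bullet> v)"

text \<open>The entries of the product (transpose of \<open>A\<close>) \<open>M A\<close>.\<close>

definition blk_compress :: "(nat \<Rightarrow> real ^ 'n) \<Rightarrow> real ^ 'n ^ 'n \<Rightarrow> nat \<Rightarrow> nat \<Rightarrow> real" where
  "blk_compress A M = (\<lambda>j l. A j \<bullet> (M *v A l))"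

text \<open>
  The induced norm of an \<open>m \<times> m\<close> matrix, in the form of \<^const>\<open>onorm\<close> (\<open>h = 0\<close> contributes
  \<open>0 / 0 = 0\<close>).
\<close>

definition blk_onorm :: "nat \<Rightarrow> (nat \<Rightarrow> nat \<Rightarrow> real) \<Rightarrow> real" where
  "blk_onorm m B =
     (SUP h. L2_set (\<lambda>j. \<Sum>l<m. B j l * h l) {..<m} / L2_set h {..<m})"

text \<open>
  The norm of the type \<^typ>\<open>real ^ 'n ^ 'n\<close> is the Frobenius norm, hence the detour through
  \<^const>\<open>onorm\<close>.
\<close>

definition mat_onorm :: "real ^ 'n ^ 'n \<Rightarrow> real" where
  "mat_onorm M = onorm (\<lambda>v. M *v v)"

text \<open>
  \<open>U 1, ..., U N\<close> are the consecutive column blocks, of \<open>ns 1, ..., ns N\<close> columns, of a column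
  permutation of the identity matrix; the enumeration \<open>\<sigma>\<close> of the coordinates gives the order of
  the columns.
\<close>

definition identity_blocks :: "nat \<Rightarrow> (nat \<Rightarrow> nat) \<Rightarrow> (nat \<Rightarrow> nat \<Rightarrow> real ^ 'n) \<Rightarrow> bool" where
  "identity_blocks N ns U \<longleftrightarrow>
     (\<Sum>i=1..N. ns i) = CARD('n) \<and>
     (\<exists>\<sigma>. bij_betw \<sigma> {..<CARD('n)} (UNIV :: 'n set) \<and>
        (\<forall>i\<in>{1..N}. \<forall>j<ns i. U i j = axis (\<sigma> ((\<Sum>l=1..<i. ns l) + j)) 1))"

definition grad :: "(real ^ 'n \<Rightarrow> real) \<Rightarrow> real ^ 'n \<Rightarrow> real ^ 'n" where
  "grad f x = (THE D. GDERIV f x :> D)"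

lemma GDERIV_grad:
  fixes f :: "real ^ 'n \<Rightarrow> real"
  assumes "f differentiable (at x)"
  shows "GDERIV f x :> grad f x"
proof -
  obtain f' where f': "(f has_derivative f') (at x)"
    using assms by (auto simp: differentiable_def)
  then have lin: "linear f'"
    by (rule has_derivative_linear)
  define D where "D = adjoint f' 1"
  have eq: "f' = (\<lambda>h. h \<bullet> D)"
  proof
    show "f' h = h \<bullet> D" for h
      using adjoint_works[OF lin, of h 1] by (simp add: D_def)
  qed
  have D: "GDERIV f x :> D"
    using f' unfolding gderiv_def eq .
  have "E = D" if "GDERIV f x :> E" for E
  proof -
    have "(\<lambda>h. h \<bullet> E) = (\<lambda>h. h \<bullet> D)"
      by (rule has_derivative_unique[OF that[unfolded gderiv_def] D[unfolded gderiv_def]])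
    from fun_cong[OF this] show ?thesis
      by (subst vector_eq_ldot[symmetric]) simp
  qed
  with D show ?thesis
    unfolding grad_def by (rule theI)
qed

definition hessian :: "(real ^ 'n \<Rightarrow> real) \<Rightarrow> real ^ 'n \<Rightarrow> real ^ 'n ^ 'n" where
  "hessian f x = jacobian (grad f) (at x)"

definition assm_A1 ::
  "nat \<Rightarrow> (nat \<Rightarrow> nat) \<Rightarrow> (nat \<Rightarrow> nat \<Rightarrow> real ^ 'n) \<Rightarrow> (nat \<Rightarrow> real) \<Rightarrow> (real ^ 'n \<Rightarrow> real) \<Rightarrow> bool"
where
  "assm_A1 N ns U L f \<longleftrightarrow>
     (\<forall>i\<in>{1..N}. \<forall>x h.
        L2_set (blk_tmult (U i) (grad f (x + blk_mult (ns i) (U i) h) - grad f x)) {..<ns i}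
          \<le> L i * L2_set h {..<ns i})"

definition assm_A2 :: "(real ^ 'n \<Rightarrow> real) \<Rightarrow> bool" where
  "assm_A2 \<psi> \<longleftrightarrow>
     (\<forall>x. \<psi> differentiable (at x)) \<and> (\<forall>x. grad \<psi> differentiable (at x)) \<and>
     continuous_on UNIV (hessian \<psi>)"

definition assm_A3 :: "(real ^ 'n \<Rightarrow> real) \<Rightarrow> bool" where
  "assm_A3 F \<longleftrightarrow> (\<exists>xs. \<forall>y. F xs \<le> F y)"

definition assm_A4 ::
  "nat \<Rightarrow> (nat \<Rightarrow> nat) \<Rightarrow> (nat \<Rightarrow> nat \<Rightarrow> real ^ 'n) \<Rightarrow> real \<Rightarrow> nat \<Rightarrow> (real ^ 'n \<Rightarrow> real) \<Rightarrow> bool"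
where
  "assm_A4 N ns U H\<psi> p \<psi> \<longleftrightarrow>
     H\<psi> > 0 \<and> p \<ge> 1 \<and>
     (\<forall>i\<in>{1..N}. \<forall>y. blk_onorm (ns i) (blk_compress (U i) (hessian \<psi> y)) \<le> H\<psi> * norm y ^ p)"

definition assm_A5 :: "real \<Rightarrow> (real ^ 'n \<Rightarrow> real) \<Rightarrow> bool" where
  "assm_A5 L\<psi> \<psi> \<longleftrightarrow>
     L\<psi> > 0 \<and> (\<forall>x y. mat_onorm (hessian \<psi> y - hessian \<psi> x) \<le> L\<psi> * norm (y - x))"

definition assm_A6 ::
  "nat \<Rightarrow> (nat \<Rightarrow> nat) \<Rightarrow> (nat \<Rightarrow> nat \<Rightarrow> real ^ 'n) \<Rightarrow> (real ^ 'n \<Rightarrow> real) \<Rightarrow> bool"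
where
  "assm_A6 N ns U \<psi> \<longleftrightarrow>
     (\<forall>i\<in>{1..N}. \<forall>x d.
        \<psi> (x + blk_mult (ns i) (U i) d)
          \<le> \<psi> x + (\<Sum>j<ns i. blk_tmult (U i) (grad \<psi> x) j * d j))"

text \<open>
  The four rules. In a given iteration, \<open>y\<close> is the current iterate, \<open>x0\<close> the starting point,
  \<open>g\<close> the norm of the selected block of the gradient of \<open>F\<close> at \<open>y\<close>, \<open>Hf\<close> the constant attached
  to the selected block, and \<open>H\<close> the computed stepsize parameter.
\<close>

definition rule1 :: "real \<Rightarrow> nat \<Rightarrow> real \<Rightarrow> real ^ 'n \<Rightarrow> real \<Rightarrow> real \<Rightarrow> real \<Rightarrow> bool" where
  "rule1 H\<psi> p L\<psi> y g Hf H \<longleftrightarrow>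
     (\<exists>\<alpha>\<ge>0. L\<psi> / 6 * \<alpha>\<^sup>2 + (H\<psi> / 2 * norm y ^ p + Hf) * \<alpha> - g = 0 \<and>
            H = H\<psi> / 2 * norm y ^ p + L\<psi> / 6 * \<alpha> + Hf)"

definition rule2 :: "real \<Rightarrow> nat \<Rightarrow> real ^ 'n \<Rightarrow> real \<Rightarrow> real \<Rightarrow> real \<Rightarrow> bool" where
  "rule2 H\<psi> p y g Hf H \<longleftrightarrow>
     (\<exists>\<alpha>\<ge>0. 2 ^ (p - 1) * H\<psi> * \<alpha> ^ (p + 1) + (2 ^ (p - 1) * H\<psi> * norm y ^ p + Hf) * \<alpha> = g \<and>
            H = 2 ^ (p - 1) * H\<psi> * norm y ^ p + 2 ^ (p - 1) * H\<psi> * \<alpha> ^ p + Hf)"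

definition rule3 ::
  "real \<Rightarrow> (real ^ 'n \<Rightarrow> real) \<Rightarrow> real ^ 'n \<Rightarrow> real ^ 'n \<Rightarrow> real \<Rightarrow> real \<Rightarrow> real \<Rightarrow> bool"
where
  "rule3 L\<psi> \<psi> x0 y g Hf H \<longleftrightarrow>
     (\<exists>\<alpha>\<ge>0. L\<psi> / 6 * \<alpha>\<^sup>2 +
              (L\<psi> / 2 * norm (y - x0) + 1 / 2 * mat_onorm (hessian \<psi> x0) + Hf) * \<alpha> = g \<and>
            H = L\<psi> / 2 * norm (y - x0) + 1 / 2 * mat_onorm (hessian \<psi> x0) + L\<psi> / 6 * \<alpha> + Hf)"

definition rule4 :: "real \<Rightarrow> real \<Rightarrow> bool" where
  "rule4 Hf H \<longleftrightarrow> H = Hf"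

text \<open>
  The iteration for arbitrary stepsize parameters \<open>HF\<close>; \<open>blk_grad_norm\<close> is the quantity that
  enters the rules.
\<close>

definition cgd_step ::
  "nat \<Rightarrow> (nat \<Rightarrow> real ^ 'n) \<Rightarrow> (real ^ 'n \<Rightarrow> real) \<Rightarrow> real \<Rightarrow> real ^ 'n \<Rightarrow> (nat \<Rightarrow> real) \<Rightarrow> real ^ 'n
    \<Rightarrow> bool"
where
  "cgd_step m A F H y d y' \<longleftrightarrow>
     H > 0 \<and> (\<forall>j<m. d j = - (1 / H) * blk_tmult A (grad F y) j) \<and> y' = y + blk_mult m A d"

definition blk_grad_norm :: "nat \<Rightarrow> (nat \<Rightarrow> real ^ 'n) \<Rightarrow> (real ^ 'n \<Rightarrow> real) \<Rightarrow> real ^ 'n \<Rightarrow> real" where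
  "blk_grad_norm m A F y = L2_set (blk_tmult A (grad F y)) {..<m}"

end

theory Submission
  imports Defs
begin

text \<open>
  With \<open>h = U d\<close>, the chosen step satisfies \<open>\<langle>\<nabla>F x, h\<rangle> = - H \<parallel>d\<parallel>\<^sup>2\<close>, while A.1 bounds the
  second-order error of \<open>f\<close> along the segment from \<open>x\<close> to \<open>x + h\<close> by \<open>L / 2 \<parallel>d\<parallel>\<^sup>2\<close>. So it suffices
  that the second-order error of \<open>\<psi>\<close> is at most \<open>(H - Hf) \<parallel>d\<parallel>\<^sup>2\<close>. In Rules 1 to 3 the scalar equation
  says \<open>\<alpha> H = \<parallel>U\<^sup>T \<nabla>F x\<parallel> = H \<parallel>d\<parallel>\<close>, that is \<open>\<alpha> = \<parallel>d\<parallel>\<close>, and this bound is Taylor's formula with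
  the curvature of \<open>\<psi>\<close> along \<open>h\<close> estimated by A.4 and A.5; in Rule 4 the error is nonpositive by A.6.
\<close>

section \<open>Taylor upper bounds on the line\<close>

text \<open>The antiderivative of the quadratic bound minus \<open>\<phi>\<close> is nondecreasing
  on [0, s]. The endpoint s stays free because the second-order version needs a bound on the
  derivative at every t in [0, 1].\<close>

lemma taylor_upper_first_order:
  fixes \<phi> \<phi>' :: "real \<Rightarrow> real"
  assumes D: "\<And>t. (\<phi> has_real_derivative \<phi>' t) (at t)"
    and le: "\<And>t. 0 \<le> t \<Longrightarrow> t \<le> s \<Longrightarrow> \<phi>' t \<le> c + a * t + b / 2 * t\<^sup>2"
    and s: "0 \<le> s"
  shows "\<phi> s \<le> \<phi> 0 + c * s + a / 2 * s\<^sup>2 + b / 6 * s ^ 3"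
proof -
  let ?g = "\<lambda>t. c * t + a / 2 * t\<^sup>2 + b / 6 * t ^ 3 - \<phi> t"
  have "?g 0 \<le> ?g s"
  proof (rule DERIV_nonneg_imp_nondecreasing[OF s])
    fix t assume t: "0 \<le> t" "t \<le> s"
    have "(?g has_real_derivative (c + a * t + b / 2 * t\<^sup>2 - \<phi>' t)) (at t)"
      by (rule derivative_eq_intros D refl | simp)+
    then show "\<exists>y. (?g has_real_derivative y) (at t) \<and> 0 \<le> y"
      using le[OF t] by fastforce
  qed
  then show ?thesis by simp
qed

lemma taylor_upper_second_order:
  fixes \<phi> \<phi>' \<phi>'' :: "real \<Rightarrow> real"
  assumes D: "\<And>t. (\<phi> has_real_derivative \<phi>' t) (at t)"
    and D2: "\<And>t. (\<phi>' has_real_derivative \<phi>'' t) (at t)"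
    and le: "\<And>t. 0 \<le> t \<Longrightarrow> t \<le> 1 \<Longrightarrow> \<phi>'' t \<le> a + b * t"
  shows "\<phi> 1 \<le> \<phi> 0 + \<phi>' 0 + a / 2 + b / 6"
proof -
  \<comment> \<open>The linear bound on \<open>\<phi>''\<close> is integrated first: a and b serve
    as constant and linear coefficients, with quadratic coefficient 0.\<close>
  have "\<phi>' t \<le> \<phi>' 0 + a * t + b / 2 * t\<^sup>2" if "0 \<le> t" "t \<le> 1" for t
    using taylor_upper_first_order[OF D2, of t a b 0] le that by simp
  from taylor_upper_first_order[OF D, of 1, OF this] show ?thesis by simp
qed

section \<open>Derivatives along a segment\<close>

lemma has_real_derivative_along_line:
  fixes f :: "real ^ 'n \<Rightarrow> real"
  assumes "\<forall>y. f differentiable (at y)"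
  shows "((\<lambda>t. f (x + t *\<^sub>R h)) has_real_derivative grad f (x + t *\<^sub>R h) \<bullet> h) (at t)"
proof -
  have "(f has_derivative (\<lambda>v. v \<bullet> grad f (x + t *\<^sub>R h))) (at (x + t *\<^sub>R h))"
    using GDERIV_grad assms unfolding gderiv_def by blast
  moreover have "((\<lambda>t. x + t *\<^sub>R h) has_derivative (\<lambda>s. s *\<^sub>R h)) (at t)"
    by (auto intro!: derivative_eq_intros)
  ultimately
  have "((\<lambda>t. f (x + t *\<^sub>R h)) has_derivative (\<lambda>s. (s *\<^sub>R h) \<bullet> grad f (x + t *\<^sub>R h))) (at t)"
    by (rule has_derivative_compose[rotated])
  then show ?thesis
    by (simp add: has_field_derivative_def inner_commute mult_commute_abs)
qed

lemma has_real_derivative_grad_along_line: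
  fixes f :: "real ^ 'n \<Rightarrow> real"
  assumes "\<forall>y. grad f differentiable (at y)"
  shows "((\<lambda>t. grad f (x + t *\<^sub>R h) \<bullet> h) has_real_derivative
           h \<bullet> (hessian f (x + t *\<^sub>R h) *v h)) (at t)"
proof -
  have "(grad f has_derivative (\<lambda>v. hessian f (x + t *\<^sub>R h) *v v)) (at (x + t *\<^sub>R h))"
    unfolding hessian_def using assms by (simp add: jacobian_works[symmetric])
  moreover have "((\<lambda>t. x + t *\<^sub>R h) has_derivative (\<lambda>s. s *\<^sub>R h)) (at t)"
    by (auto intro!: derivative_eq_intros)
  ultimately
  have "((\<lambda>t. grad f (x + t *\<^sub>R h)) has_derivative
          (\<lambda>s. hessian f (x + t *\<^sub>R h) *v (s *\<^sub>R h))) (at t)"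
    by (rule has_derivative_compose[rotated])
  from has_derivative_inner_left[OF this, of h] show ?thesis
    by (simp add: has_field_derivative_def inner_commute mult_commute_abs matrix_vector_mult_scaleR)
qed

text \<open>Integrating a + b t twice along the segment gives a/2 + b/6, the source of the factors
  1/2 and 1/6 in Rules 1 and 3.\<close>

lemma second_order_upper_bound:
  fixes \<psi> :: "real ^ 'n \<Rightarrow> real"
  assumes A2: "assm_A2 \<psi>"
    and le: "\<And>t. 0 \<le> t \<Longrightarrow> t \<le> 1 \<Longrightarrow> h \<bullet> (hessian \<psi> (y + t *\<^sub>R h) *v h) \<le> a + b * t"
  shows "\<psi> (y + h) \<le> \<psi> y + grad \<psi> y \<bullet> h + a / 2 + b / 6"
proof -
  have "\<forall>y. \<psi> differentiable (at y)" "\<forall>y. grad \<psi> differentiable (at y)"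
    using A2 by (simp_all add: assm_A2_def)
  from taylor_upper_second_order[OF has_real_derivative_along_line[OF this(1), of y h]
      has_real_derivative_grad_along_line[OF this(2), of y h] le]
  show ?thesis by simp
qed

section \<open>Block products and orthonormal columns\<close>

lemma inner_blk_mult: "v \<bullet> blk_mult m A d = (\<Sum>j<m. blk_tmult A v j * d j)"
  by (simp add: blk_mult_def blk_tmult_def inner_sum_right inner_commute mult.commute)

text \<open>Adjointness moves the inner product to block coordinates, where Cauchy-Schwarz applies.
  Only the block component of v enters, which is what A.1 controls.\<close>

lemma inner_blk_mult_le:
  "v \<bullet> blk_mult m A d \<le> L2_set (blk_tmult A v) {..<m} * L2_set d {..<m}"
proof -
  have "(\<Sum>j<m. blk_tmult A v j * d j) \<le> (\<Sum>j<m. \<bar>blk_tmult A v j\<bar> * \<bar>d j\<bar>)"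
    by (intro sum_mono) (metis abs_ge_self abs_mult)
  also have "\<dots> \<le> L2_set (blk_tmult A v) {..<m} * L2_set d {..<m}"
    by (rule L2_set_mult_ineq)
  finally show ?thesis by (simp add: inner_blk_mult)
qed

lemma blk_mult_scale: "blk_mult m A (\<lambda>j. t * d j) = t *\<^sub>R blk_mult m A d"
  by (simp add: blk_mult_def scaleR_sum_right)

text \<open>Orthonormality makes the transpose of A a left inverse of A, so adjointness turns the
  squared norm of A d into that of d.\<close>

lemma norm_blk_mult:
  assumes "\<And>j l. j < m \<Longrightarrow> l < m \<Longrightarrow> A j \<bullet> A l = (if j = l then 1 else 0)"
  shows "norm (blk_mult m A d) = L2_set d {..<m}"
proof -
  have "blk_tmult A (blk_mult m A d) j = d j" if "j < m" for j
  proof -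
    have "blk_tmult A (blk_mult m A d) j = (\<Sum>l<m. if l = j then d l else 0)"
      unfolding blk_tmult_def inner_blk_mult using that assms by (intro sum.cong) auto
    then show ?thesis using that by simp
  qed
  then have "blk_mult m A d \<bullet> blk_mult m A d = (\<Sum>j<m. (d j)\<^sup>2)"
    by (simp add: inner_blk_mult[of "blk_mult m A d"] power2_eq_square)
  then show ?thesis
    by (simp add: norm_eq_sqrt_inner L2_set_def)
qed

lemma identity_blocks_orthonormal:
  assumes U: "identity_blocks N ns (U :: nat \<Rightarrow> nat \<Rightarrow> real ^ 'n)" and i: "i \<in> {1..N}"
    and j: "j < ns i" and l: "l < ns i"
  shows "U i j \<bullet> U i l = (if j = l then 1 else 0)"
proof -
  let ?s = "\<Sum>l=1..<i. ns l"
  obtain \<sigma> where \<sigma>: "bij_betw \<sigma> {..<CARD('n)} (UNIV :: 'n set)"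
    and Ui: "\<And>j. j < ns i \<Longrightarrow> U i j = axis (\<sigma> (?s + j)) 1"
    and card: "(\<Sum>i=1..N. ns i) = CARD('n)"
    using U i unfolding identity_blocks_def by blast
  \<comment> \<open>The positions used by the block must stay below the dimension, since
    \<open>\<sigma>\<close> is known to be injective only there.\<close>
  have "?s + ns i = (\<Sum>l\<in>insert i {1..<i}. ns l)"
    by simp
  also have "\<dots> \<le> CARD('n)"
    unfolding card[symmetric] using i by (intro sum_mono2) auto
  finally have "\<sigma> (?s + j) = \<sigma> (?s + l) \<longleftrightarrow> j = l"
    using inj_on_eq_iff[OF bij_betw_imp_inj_on[OF \<sigma>], of "?s + j" "?s + l"] j l by auto
  then show ?thesis
    using Ui j l by (simp add: inner_axis_axis)
qed

section \<open>Quadratic forms and operator norms\<close>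

text \<open>The supremum dominates each quotient once the quotients are bounded above; the sum of
  all \<open>\<bar>B j l\<bar>\<close> is such a bound. The case h = 0 is separate because its
  quotient carries no information.\<close>

lemma blk_onorm_bound:
  "L2_set (\<lambda>j. \<Sum>l<m. B j l * h l) {..<m} \<le> blk_onorm m B * L2_set h {..<m}"
proof (cases "L2_set h {..<m} = 0")
  case True
  then have "\<forall>l<m. h l = 0"
    by (simp add: L2_set_eq_0_iff)
  then have "(\<Sum>l<m. B j l * h l) = 0" for j
    by simp
  with True show ?thesis by (simp add: L2_set_def)
next
  case False
  then have pos: "0 < L2_set h {..<m}"
    by (simp add: order_less_le)
  let ?q = "\<lambda>h. L2_set (\<lambda>j. \<Sum>l<m. B j l * h l) {..<m} / L2_set h {..<m}"
  have "?q h \<le> (\<Sum>j<m. \<Sum>l<m. \<bar>B j l\<bar>)" for h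
  proof -
    have "L2_set (\<lambda>j. \<Sum>l<m. B j l * h l) {..<m} \<le> (\<Sum>j<m. \<bar>\<Sum>l<m. B j l * h l\<bar>)"
      by (rule L2_set_le_sum_abs)
    also have "\<dots> \<le> (\<Sum>j<m. \<Sum>l<m. \<bar>B j l\<bar> * L2_set h {..<m})"
    proof (intro sum_mono order_trans[OF sum_abs])
      fix j l assume "l \<in> {..<m}"
      then have "\<bar>h l\<bar> \<le> L2_set h {..<m}"
        using member_le_L2_set[of "{..<m}" l "\<lambda>j. \<bar>h j\<bar>"] by (simp add: L2_set_def)
      then show "\<bar>B j l * h l\<bar> \<le> \<bar>B j l\<bar> * L2_set h {..<m}"
        by (simp add: abs_mult mult_left_mono)
    qed
    finally have "L2_set (\<lambda>j. \<Sum>l<m. B j l * h l) {..<m}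
        \<le> (\<Sum>j<m. \<Sum>l<m. \<bar>B j l\<bar>) * L2_set h {..<m}"
      by (simp add: sum_distrib_right)
    then show ?thesis
      by (cases "L2_set h {..<m} = 0") (auto simp: sum_nonneg pos_divide_le_eq order_less_le)
  qed
  then have "bdd_above (range ?q)"
    by (auto intro!: bdd_aboveI)
  then have "?q h \<le> blk_onorm m B"
    unfolding blk_onorm_def by (rule cSUP_upper[OF UNIV_I])
  then show ?thesis
    using pos by (simp add: pos_divide_le_eq)
qed

text \<open>The form is the inner product of d with the compressed matrix applied to d. This turns
  A.4 into a curvature bound along block directions.\<close>

lemma blk_quadratic_form_le:
  "blk_mult m A d \<bullet> (M *v blk_mult m A d)
     \<le> blk_onorm m (blk_compress A M) * (L2_set d {..<m})\<^sup>2"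
proof -
  have *: "blk_tmult A (M *v blk_mult m A d) = (\<lambda>j. \<Sum>l<m. blk_compress A M j l * d l)"
    by (simp add: fun_eq_iff blk_tmult_def blk_mult_def blk_compress_def
        linear_sum[OF matrix_vector_mul_linear] matrix_vector_mult_scaleR inner_sum_right mult.commute)
  have "(M *v blk_mult m A d) \<bullet> blk_mult m A d
      \<le> L2_set (\<lambda>j. \<Sum>l<m. blk_compress A M j l * d l) {..<m} * L2_set d {..<m}"
    using inner_blk_mult_le[of "M *v blk_mult m A d" m A d] by (simp add: *)
  also have "\<dots> \<le> blk_onorm m (blk_compress A M) * L2_set d {..<m} * L2_set d {..<m}"
    by (intro mult_right_mono blk_onorm_bound) simp
  finally show ?thesis
    by (simp add: inner_commute power2_eq_square mult.assoc)
qed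

lemma mat_onorm_quadratic_form_le: "v \<bullet> (M *v v) \<le> mat_onorm M * (norm v)\<^sup>2"
proof -
  have "v \<bullet> (M *v v) \<le> norm v * norm (M *v v)"
    by (rule norm_cauchy_schwarz)
  also have "\<dots> \<le> norm v * (mat_onorm M * norm v)"
    unfolding mat_onorm_def
    by (intro mult_left_mono onorm matrix_vector_mul_bounded_linear) simp
  finally show ?thesis
    by (simp add: power2_eq_square ac_simps)
qed

text \<open>A.5 controls the form of the difference of the two Hessians, so a curvature bound can be
  carried from one base point to another.\<close>

lemma assm_A5_quadratic_form_le:
  assumes "assm_A5 L \<psi>"
  shows "v \<bullet> (hessian \<psi> y *v v)
    \<le> v \<bullet> (hessian \<psi> z *v v) + L * norm (y - z) * (norm v)\<^sup>2"
proof -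
  have "v \<bullet> (hessian \<psi> y *v v) - v \<bullet> (hessian \<psi> z *v v)
      = v \<bullet> ((hessian \<psi> y - hessian \<psi> z) *v v)"
    by (simp add: matrix_vector_mult_diff_rdistrib inner_diff_right)
  also have "\<dots> \<le> mat_onorm (hessian \<psi> y - hessian \<psi> z) * (norm v)\<^sup>2"
    by (rule mat_onorm_quadratic_form_le)
  also have "\<dots> \<le> L * norm (y - z) * (norm v)\<^sup>2"
    using assms by (intro mult_right_mono) (auto simp: assm_A5_def)
  finally show ?thesis by simp
qed

section \<open>Upper bound for f\<close>

text \<open>A.1 with displacement t d bounds the growth of the slope along h by a multiple of t;
  integrating t over [0, 1] gives the factor 1/2.\<close>

lemma assm_A1_upper_bound:
  fixes d :: "nat \<Rightarrow> real"
  assumes f: "\<forall>y. f differentiable (at y)" and A1: "assm_A1 N ns U L f" and i: "i \<in> {1..N}"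
  defines "h \<equiv> blk_mult (ns i) (U i) d"
  shows "f (y + h) \<le> f y + grad f y \<bullet> h + L i / 2 * (L2_set d {..<ns i})\<^sup>2"
proof -
  let ?D = "L2_set d {..<ns i}"
  have "grad f (y + t *\<^sub>R h) \<bullet> h \<le> grad f y \<bullet> h + L i * ?D\<^sup>2 * t + 0 / 2 * t\<^sup>2" if t: "0 \<le> t" for t
  proof -
    have "(grad f (y + t *\<^sub>R h) - grad f y) \<bullet> h
        \<le> L2_set (blk_tmult (U i) (grad f (y + t *\<^sub>R h) - grad f y)) {..<ns i} * ?D"
      unfolding h_def by (rule inner_blk_mult_le)
    also have "\<dots> \<le> L i * L2_set (\<lambda>j. t * d j) {..<ns i} * ?D"
      using A1[unfolded assm_A1_def, rule_format, OF i, of y "\<lambda>j. t * d j"]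
      by (intro mult_right_mono) (simp_all add: h_def blk_mult_scale)
    also have "\<dots> = L i * ?D\<^sup>2 * t"
      using t by (simp add: L2_set_right_distrib[symmetric] power2_eq_square)
    finally show ?thesis by (simp add: inner_diff_left)
  qed
  from taylor_upper_first_order[OF has_real_derivative_along_line[OF f, of y h] this, of 1]
  show ?thesis by simp
qed

section \<open>Identities for one step\<close>

text \<open>Solving the step equation for the block gradient gives -H d. This is what lets \<alpha>
  in the rules be compared with the norm of d.\<close>

lemma cgd_step_norm:
  assumes "cgd_step m A F H y d y'"
  shows "blk_grad_norm m A F y = H * L2_set d {..<m}"
proof -
  have H: "H > 0" and d: "\<And>j. j < m \<Longrightarrow> d j = - (1 / H) * blk_tmult A (grad F y) j"
    using assms unfolding cgd_step_def by blast+
  have "L2_set (blk_tmult A (grad F y)) {..<m} = L2_set (\<lambda>j. H * d j) {..<m}"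
    unfolding L2_set_def using H d by (intro arg_cong[where f = sqrt] sum.cong) auto
  then show ?thesis
    using H by (simp add: blk_grad_norm_def L2_set_right_distrib)
qed

lemma cgd_step_inner:
  assumes "cgd_step m A F H y d y'"
  shows "grad F y \<bullet> blk_mult m A d = - H * (L2_set d {..<m})\<^sup>2"
proof -
  have H: "H > 0" and d: "\<And>j. j < m \<Longrightarrow> d j = - (1 / H) * blk_tmult A (grad F y) j"
    using assms unfolding cgd_step_def by blast+
  have "(\<Sum>j<m. blk_tmult A (grad F y) j * d j) = (\<Sum>j<m. - H * (d j)\<^sup>2)"
    using H d by (intro sum.cong) (auto simp: power2_eq_square)
  then show ?thesis
    by (simp add: inner_blk_mult L2_set_def sum_nonneg sum_distrib_left)
qed

lemma grad_add:
  fixes f g :: "real ^ 'n \<Rightarrow> real"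
  assumes "f differentiable (at y)" "g differentiable (at y)"
  shows "grad (\<lambda>z. f z + g z) y = grad f y + grad g y"
proof -
  have "GDERIV (\<lambda>z. f z + g z) y :> grad (\<lambda>z. f z + g z) y"
    using assms by (intro GDERIV_grad differentiable_add)
  moreover have "GDERIV (\<lambda>z. f z + g z) y :> grad f y + grad g y"
    using assms by (intro GDERIV_add GDERIV_grad)
  ultimately have "(\<lambda>h. h \<bullet> grad (\<lambda>z. f z + g z) y) = (\<lambda>h. h \<bullet> (grad f y + grad g y))"
    unfolding gderiv_def by (rule has_derivative_unique)
  then show ?thesis
    by (metis vector_eq_ldot)
qed

text \<open>
  Rule 2 has \<open>2 ^ (p - 1)\<close> where Taylor's formula would give half of it, so the constant need not be
  the sharp \<open>2 ^ (p - 1)\<close>.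
\<close>

lemma power_add_le_two_power:
  fixes a b :: real
  assumes "0 \<le> a" "0 \<le> b"
  shows "(a + b) ^ p \<le> 2 ^ p * (a ^ p + b ^ p)"
proof -
  have "(a + b) ^ p \<le> (2 * max a b) ^ p"
    using assms by (intro power_mono) auto
  also have "\<dots> \<le> 2 ^ p * (a ^ p + b ^ p)"
    using assms by (auto simp: power_mult_distrib max_def)
  finally show ?thesis .
qed

section \<open>Bounds for \<psi> under the four rules\<close>

text \<open>A.4 bounds the curvature at y, giving the constant term a; A.5 adds the term linear in
  t. Once \<alpha> is the norm of d, a/2 + b/6 is exactly H - Hf times the squared norm of
  d.\<close>

lemma rule1_upper_bound:
  fixes \<psi> :: "real ^ 'n \<Rightarrow> real"
  assumes U: "identity_blocks N ns U" and A2: "assm_A2 \<psi>" and i: "i \<in> {1..N}"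
    and A4: "assm_A4 N ns U H\<psi> p \<psi>" and A5: "assm_A5 L\<psi> \<psi>"
    and step: "cgd_step (ns i) (U i) F H y d y'"
    and rule: "rule1 H\<psi> p L\<psi> y (blk_grad_norm (ns i) (U i) F y) Hf H"
  shows "\<psi> y' \<le> \<psi> y + grad \<psi> y \<bullet> blk_mult (ns i) (U i) d + (H - Hf) * (L2_set d {..<ns i})\<^sup>2"
proof -
  let ?D = "L2_set d {..<ns i}" and ?h = "blk_mult (ns i) (U i) d"
  have y': "y' = y + ?h" and H: "H > 0"
    using step by (auto simp: cgd_step_def)
  have h: "norm ?h = ?D"
    by (rule norm_blk_mult) (rule identity_blocks_orthonormal[OF U i])
  obtain \<alpha> where eq: "L\<psi> / 6 * \<alpha>\<^sup>2 + (H\<psi> / 2 * norm y ^ p + Hf) * \<alpha> - H * ?D = 0"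
    and He: "H = H\<psi> / 2 * norm y ^ p + L\<psi> / 6 * \<alpha> + Hf"
    using rule unfolding rule1_def cgd_step_norm[OF step] by blast
  \<comment> \<open>Factoring \<alpha> out of the root equation leaves the rule's expression for H,
    which is positive and cancels.\<close>
  have "\<alpha> * H = H * ?D"
    using eq by (subst He) (simp add: algebra_simps power2_eq_square)
  with H have \<alpha>: "\<alpha> = ?D" by simp
  have "?h \<bullet> (hessian \<psi> (y + t *\<^sub>R ?h) *v ?h) \<le> H\<psi> * norm y ^ p * ?D\<^sup>2 + L\<psi> * ?D ^ 3 * t"
    if t: "0 \<le> t" for t
  proof -
    have "?h \<bullet> (hessian \<psi> y *v ?h)
        \<le> blk_onorm (ns i) (blk_compress (U i) (hessian \<psi> y)) * ?D\<^sup>2"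
      by (rule blk_quadratic_form_le)
    also have "\<dots> \<le> H\<psi> * norm y ^ p * ?D\<^sup>2"
      using A4 i by (intro mult_right_mono) (auto simp: assm_A4_def)
    finally show ?thesis
      using assm_A5_quadratic_form_le[OF A5, of ?h "y + t *\<^sub>R ?h" y] t
      by (simp add: h power2_eq_square power3_eq_cube algebra_simps)
  qed
  from second_order_upper_bound[OF A2 this] show ?thesis
    unfolding y' He \<alpha> by (simp add: power2_eq_square power3_eq_cube algebra_simps)
qed

text \<open>Instead of comparing Hessians, A.4 is applied at every point of the segment, whose norm
  is at most that of y plus that of d. The curvature bound is constant in t, so b = 0 in Taylor's
  formula.\<close>

lemma rule2_upper_bound:
  fixes \<psi> :: "real ^ 'n \<Rightarrow> real"
  assumes U: "identity_blocks N ns U" and A2: "assm_A2 \<psi>" and i: "i \<in> {1..N}"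
    and A4: "assm_A4 N ns U H\<psi> p \<psi>"
    and step: "cgd_step (ns i) (U i) F H y d y'"
    and rule: "rule2 H\<psi> p y (blk_grad_norm (ns i) (U i) F y) Hf H"
  shows "\<psi> y' \<le> \<psi> y + grad \<psi> y \<bullet> blk_mult (ns i) (U i) d + (H - Hf) * (L2_set d {..<ns i})\<^sup>2"
proof -
  let ?D = "L2_set d {..<ns i}" and ?h = "blk_mult (ns i) (U i) d"
  let ?c = "H\<psi> * (2 ^ p * (norm y ^ p + ?D ^ p)) * ?D\<^sup>2"
  have y': "y' = y + ?h" and H: "H > 0"
    using step by (auto simp: cgd_step_def)
  have H\<psi>: "H\<psi> > 0" and p: "p \<ge> 1"
    using A4 by (auto simp: assm_A4_def)
  have h: "norm ?h = ?D"
    by (rule norm_blk_mult) (rule identity_blocks_orthonormal[OF U i])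
  obtain \<alpha> where eq: "2 ^ (p - 1) * H\<psi> * \<alpha> ^ (p + 1) + (2 ^ (p - 1) * H\<psi> * norm y ^ p + Hf) * \<alpha> = H * ?D"
    and He: "H = 2 ^ (p - 1) * H\<psi> * norm y ^ p + 2 ^ (p - 1) * H\<psi> * \<alpha> ^ p + Hf"
    using rule unfolding rule2_def cgd_step_norm[OF step] by blast
  have "\<alpha> * H = H * ?D"
    using eq by (subst He) (simp add: algebra_simps)
  with H have \<alpha>: "\<alpha> = ?D" by simp
  have "?h \<bullet> (hessian \<psi> (y + t *\<^sub>R ?h) *v ?h) \<le> ?c + 0 * t" if t: "0 \<le> t" "t \<le> 1" for t
  proof -
    have "norm (y + t *\<^sub>R ?h) \<le> norm y + t * ?D"
      using norm_triangle_ineq[of y "t *\<^sub>R ?h"] t by (simp add: h)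
    also have "\<dots> \<le> norm y + ?D"
      using t by (simp add: mult_left_le_one_le)
    finally have "norm (y + t *\<^sub>R ?h) ^ p \<le> (norm y + ?D) ^ p"
      by (intro power_mono) auto
    also have "\<dots> \<le> 2 ^ p * (norm y ^ p + ?D ^ p)"
      by (rule power_add_le_two_power) auto
    finally have pw: "norm (y + t *\<^sub>R ?h) ^ p \<le> 2 ^ p * (norm y ^ p + ?D ^ p)" .
    have "?h \<bullet> (hessian \<psi> (y + t *\<^sub>R ?h) *v ?h)
        \<le> blk_onorm (ns i) (blk_compress (U i) (hessian \<psi> (y + t *\<^sub>R ?h))) * ?D\<^sup>2"
      by (rule blk_quadratic_form_le)
    also have "\<dots> \<le> H\<psi> * norm (y + t *\<^sub>R ?h) ^ p * ?D\<^sup>2"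
      using A4 i by (intro mult_right_mono) (auto simp: assm_A4_def)
    also have "\<dots> \<le> ?c"
      using pw H\<psi> by (intro mult_right_mono mult_left_mono) auto
    finally show ?thesis by simp
  qed
  from second_order_upper_bound[OF A2 this]
  have "\<psi> y' \<le> \<psi> y + grad \<psi> y \<bullet> ?h + ?c / 2"
    by (simp add: y')
  \<comment> \<open>The factor 1/2 of Taylor's formula turns \<open>2 ^ p\<close> into
    \<open>2 ^ (p - 1)\<close>; with truncated subtraction this needs p \<ge> 1, part of
    A.4.\<close>
  moreover have "(2::real) ^ p = 2 * 2 ^ (p - 1)"
    using p by (metis One_nat_def Suc_le_eq power_minus_mult mult.commute)
  ultimately show ?thesis
    unfolding He \<alpha> by (simp add: algebra_simps add_divide_distrib)
qed

text \<open>A.5 is used twice, from \<open>x0\<close> to y and from y to y + t h, so only the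
  Hessian at \<open>x0\<close> has to be bounded. The first comparison contributes to a, the second
  gives b.\<close>

lemma rule3_upper_bound:
  fixes \<psi> :: "real ^ 'n \<Rightarrow> real"
  assumes U: "identity_blocks N ns U" and A2: "assm_A2 \<psi>" and i: "i \<in> {1..N}"
    and A5: "assm_A5 L\<psi> \<psi>"
    and step: "cgd_step (ns i) (U i) F H y d y'"
    and rule: "rule3 L\<psi> \<psi> x0 y (blk_grad_norm (ns i) (U i) F y) Hf H"
  shows "\<psi> y' \<le> \<psi> y + grad \<psi> y \<bullet> blk_mult (ns i) (U i) d + (H - Hf) * (L2_set d {..<ns i})\<^sup>2"
proof -
  let ?D = "L2_set d {..<ns i}" and ?h = "blk_mult (ns i) (U i) d"
  let ?a = "L\<psi> * norm (y - x0) + mat_onorm (hessian \<psi> x0)"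
  have y': "y' = y + ?h" and H: "H > 0"
    using step by (auto simp: cgd_step_def)
  have h: "norm ?h = ?D"
    by (rule norm_blk_mult) (rule identity_blocks_orthonormal[OF U i])
  obtain \<alpha> where eq: "L\<psi> / 6 * \<alpha>\<^sup>2 +
        (L\<psi> / 2 * norm (y - x0) + 1 / 2 * mat_onorm (hessian \<psi> x0) + Hf) * \<alpha> = H * ?D"
    and He: "H = L\<psi> / 2 * norm (y - x0) + 1 / 2 * mat_onorm (hessian \<psi> x0) + L\<psi> / 6 * \<alpha> + Hf"
    using rule unfolding rule3_def cgd_step_norm[OF step] by blast
  have "\<alpha> * H = H * ?D"
    using eq by (subst He) (simp add: algebra_simps power2_eq_square)
  with H have \<alpha>: "\<alpha> = ?D" by simp
  have "?h \<bullet> (hessian \<psi> (y + t *\<^sub>R ?h) *v ?h) \<le> ?a * ?D\<^sup>2 + L\<psi> * ?D ^ 3 * t"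
    if t: "0 \<le> t" for t
    using assm_A5_quadratic_form_le[OF A5, of ?h "y + t *\<^sub>R ?h" y]
      assm_A5_quadratic_form_le[OF A5, of ?h y x0]
      mat_onorm_quadratic_form_le[of ?h "hessian \<psi> x0"] t
    by (simp add: h power2_eq_square power3_eq_cube algebra_simps)
  from second_order_upper_bound[OF A2 this] show ?thesis
    unfolding y' He \<alpha> by (simp add: power2_eq_square power3_eq_cube algebra_simps add_divide_distrib)
qed

text \<open>Here H = Hf makes the last term zero; keeping it gives all four rules the same
  conclusion.\<close>

lemma rule4_upper_bound:
  assumes i: "i \<in> {1..N}" and A6: "assm_A6 N ns U \<psi>"
    and step: "cgd_step (ns i) (U i) F H y d y'" and rule: "rule4 Hf H"
  shows "\<psi> y' \<le> \<psi> y + grad \<psi> y \<bullet> blk_mult (ns i) (U i) d + (H - Hf) * (L2_set d {..<ns i})\<^sup>2"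
proof -
  have "\<psi> (y + blk_mult (ns i) (U i) d) \<le> \<psi> y + grad \<psi> y \<bullet> blk_mult (ns i) (U i) d"
    using A6 i unfolding assm_A6_def inner_blk_mult by blast
  then show ?thesis
    using step rule by (simp add: cgd_step_def rule4_def)
qed

section \<open>The descent inequality\<close>

theorem lemma4p2:
  fixes f \<psi> F :: "real ^ 'n \<Rightarrow> real"
    and N :: nat and ns :: "nat \<Rightarrow> nat" and U :: "nat \<Rightarrow> nat \<Rightarrow> real ^ 'n"
    and L \<eta> Hf :: "nat \<Rightarrow> real"
    and H\<psi> L\<psi> :: real and p :: nat
    and x :: "nat \<Rightarrow> real ^ 'n" and d :: "nat \<Rightarrow> nat \<Rightarrow> real"
    and i :: "nat \<Rightarrow> nat" and HF :: "nat \<Rightarrow> real"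
  assumes F: "F = (\<lambda>y. f y + \<psi> y)"
    and f_diff: "\<forall>y. f differentiable (at y)"
    and U: "identity_blocks N ns U"
    and A1: "assm_A1 N ns U L f"
    and A2: "assm_A2 \<psi>"
    and A3: "assm_A3 F"
    and eta: "\<forall>l\<in>{1..N}. \<eta> l > 0"
    and Hf: "\<forall>l\<in>{1..N}. Hf l = (L l + \<eta> l) / 2"
    and idx: "\<forall>k. i k \<in> {1..N}"
    and step: "\<forall>k. cgd_step (ns (i k)) (U (i k)) F (HF k) (x k) (d k) (x (Suc k))"
    and rules:
      "(assm_A4 N ns U H\<psi> p \<psi> \<and> assm_A5 L\<psi> \<psi> \<and>
          (\<forall>k. rule1 H\<psi> p L\<psi> (x k) (blk_grad_norm (ns (i k)) (U (i k)) F (x k)) (Hf (i k)) (HF k)))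
       \<or> (assm_A4 N ns U H\<psi> p \<psi> \<and>
          (\<forall>k. rule2 H\<psi> p (x k) (blk_grad_norm (ns (i k)) (U (i k)) F (x k)) (Hf (i k)) (HF k)))
       \<or> (assm_A5 L\<psi> \<psi> \<and>
          (\<forall>k. rule3 L\<psi> \<psi> (x 0) (x k) (blk_grad_norm (ns (i k)) (U (i k)) F (x k)) (Hf (i k)) (HF k)))
       \<or> (assm_A6 N ns U \<psi> \<and> (\<forall>k. rule4 (Hf (i k)) (HF k)))"
  shows "\<forall>k. F (x (Suc k)) \<le> F (x k) - Min (\<eta> ` {1..N}) / 2 * (L2_set (d k) {..<ns (i k)})\<^sup>2"
proof
  fix k
  let ?D = "L2_set (d k) {..<ns (i k)}" and ?h = "blk_mult (ns (i k)) (U (i k)) (d k)"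
  have ik: "i k \<in> {1..N}" and st: "cgd_step (ns (i k)) (U (i k)) F (HF k) (x k) (d k) (x (Suc k))"
    using idx step by blast+
  have xS: "x (Suc k) = x k + ?h"
    using st by (simp add: cgd_step_def)
  have "\<psi> (x (Suc k)) \<le> \<psi> (x k) + grad \<psi> (x k) \<bullet> ?h + (HF k - Hf (i k)) * ?D\<^sup>2"
    using rules rule1_upper_bound[OF U A2 ik _ _ st] rule2_upper_bound[OF U A2 ik _ st]
      rule3_upper_bound[OF U A2 ik _ st]
      rule4_upper_bound[where ns = ns and U = U and i = "i k", OF ik _ st] by blast
  moreover have "f (x (Suc k)) \<le> f (x k) + grad f (x k) \<bullet> ?h + L (i k) / 2 * ?D\<^sup>2"
    unfolding xS by (rule assm_A1_upper_bound[OF f_diff A1 ik])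
  moreover have "(grad f (x k) + grad \<psi> (x k)) \<bullet> ?h = - HF k * ?D\<^sup>2"
    using cgd_step_inner[OF st] f_diff A2 by (simp add: F grad_add assm_A2_def)
  \<comment> \<open>The coefficients of \<open>?D\<^sup>2\<close> add up to -HF + L/2 + (HF - Hf) =
    L/2 - (L + \<eta>)/2 = -\<eta>/2, so the stepsize parameter cancels.\<close>
  ultimately have "F (x (Suc k)) \<le> F (x k) - \<eta> (i k) / 2 * ?D\<^sup>2"
    using Hf ik by (simp add: F inner_add_left algebra_simps add_divide_distrib)
  also have "\<dots> \<le> F (x k) - Min (\<eta> ` {1..N}) / 2 * ?D\<^sup>2"
    using ik by (simp add: mult_right_mono)
  finally show "F (x (Suc k)) \<le> F (x k) - Min (\<eta> ` {1..N}) / 2 * ?D\<^sup>2" .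
qed

end
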